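(* Let $d\ge1$, let $\|\cdot\|$ be any norm on $\mathbb{C}^d$, let $S\subset M_d(\mathbb{C})$ be a bounded subset, and set $n_1=2d^2$. Then $$\|S^{n_1}\|\le 2^7d^4\,\rho(S)\,\|S\|^{n_1-1}.$$
   Context: $M_d(\mathbb{C})$ is the ring of $d\times d$ complex matrices. For $S\subset M_d(\mathbb{C})$ and $n\ge1$, $S^n:=\{s_1\cdots s_n : s_i\in S\}$ is the $n$-fold product set. The symbol $\|\cdot\|$ denotes both the norm on $\mathbb{C}^d$ and its associated operator norm on $M_d(\mathbb{C})$, and $\|S\|:=\sup_{s\in S}\|s\|$. The joint spectral radius of a bounded set $S$ is $\rho(S):=\lim_{n\to+\infty}\|S^n\|^{1/n}$ (the limit exists and does not depend on the norm). *)

theory Defs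
  imports "HOL-Analysis.Analysis"
begin

definition is_norm :: "(complex ^ 'd \<Rightarrow> real) \<Rightarrow> bool" where
  "is_norm N \<longleftrightarrow>
     (\<forall>x. 0 \<le> N x) \<and>
     (\<forall>x. N x = 0 \<longleftrightarrow> x = 0) \<and>
     (\<forall>c x. N (c *s x) = cmod c * N x) \<and>
     (\<forall>x y. N (x + y) \<le> N x + N y)"

(* The term for x = 0 is 0 / 0 = 0, so it does not affect the supremum (same convention as onorm). *)
definition op_norm :: "(complex ^ 'd \<Rightarrow> real) \<Rightarrow> complex ^ 'd ^ 'd \<Rightarrow> real" where
  "op_norm N A = (SUP x. N (A *v x) / N x)"

(* The supremum is taken in the nonnegative reals: inserting 0 only matters for
   S = {}, where Sup on the reals is unspecified and the intended value is 0. *)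
definition set_norm :: "(complex ^ 'd \<Rightarrow> real) \<Rightarrow> (complex ^ 'd ^ 'd) set \<Rightarrow> real" where
  "set_norm N S = Sup (insert 0 (op_norm N ` S))"

(* Matrix multiplication is ** here; the power operation available on this type is componentwise. *)
definition prod_set :: "(complex ^ 'd ^ 'd) set \<Rightarrow> nat \<Rightarrow> (complex ^ 'd ^ 'd) set" where
  "prod_set S n = {foldr (**) As (mat 1) | As. length As = n \<and> set As \<subseteq> S}"

definition joint_spectral_radius ::
  "(complex ^ 'd \<Rightarrow> real) \<Rightarrow> (complex ^ 'd ^ 'd) set \<Rightarrow> real" where
  "joint_spectral_radius N S = lim (\<lambda>n. root n (set_norm N (prod_set S n)))"

end

theory Submission
  imports Defs
begin

text \<open>
  Normalise \<open>\<parallel>S\<parallel> = 1\<close>. For \<open>e > \<rho>(S)\<close>, Rota and Strang's norm \<open>v x = sup \<parallel>w x\<parallel> / e\<^sup>k\<close>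
  (over \<open>w \<in> S\<^sup>k\<close>, all \<open>k\<close>) is contracted by the factor \<open>e\<close> by every \<open>s \<in> S\<close>.
  Choose a flag of real subspaces \<open>V\<^sub>0 \<supset> V\<^sub>1 \<supset> \<dots> \<supset> V\<^sub>D = 0\<close>, \<open>D = 2d\<close>, greedily:
  \<open>V\<^sub>r\<^sub>+\<^sub>1\<close> is the kernel in \<open>V\<^sub>r\<close> of a functional norming, for \<open>v\<close>, a vector at which
  \<open>v / \<parallel>\<cdot>\<parallel>\<close> is maximal on \<open>V\<^sub>r\<close>. Then each \<open>x\<close> is at distance at most \<open>C v x\<close> from \<open>V\<^sub>r\<^sub>+\<^sub>1\<close>, where
  \<open>C v \<le> 2\<^sup>r\<^sup>+\<^sup>1 \<parallel>\<cdot>\<parallel>\<close> on \<open>V\<^sub>r\<close>. So a product of \<open>d\<close> further matrices moves a vector of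
  \<open>V\<^sub>r\<close> to within \<open>O(4\<^sup>d e\<^sup>d) = O(e)\<close> of \<open>V\<^sub>r\<^sub>+\<^sub>1\<close> if \<open>4 e \<le> 1\<close>; the exponential loss of the flag is
  paid for by the \<open>d\<close> contractions. The errors add up because the original norm does not increase,
  and after \<open>2d\<^sup>2\<close> steps the flag is exhausted.
\<close>

section \<open>Norms on a real Euclidean space\<close>

text \<open>A norm is a function here because two of them are compared on one space. Scalars are
  real: \<open>complex ^ 'd\<close> enters later as a real space of dimension 2d.\<close>

locale vnorm =
  fixes N :: "'a::euclidean_space \<Rightarrow> real"
  assumes nonneg: "0 \<le> N x"
    and eq_0_iff: "N x = 0 \<longleftrightarrow> x = 0"
    and scaleR: "N (c *\<^sub>R x) = \<bar>c\<bar> * N x"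
    and triangle: "N (x + y) \<le> N x + N y"
begin

lemma zero [simp]: "N 0 = 0"
  by (simp add: eq_0_iff)

lemma pos: "x \<noteq> 0 \<Longrightarrow> 0 < N x"
  using nonneg[of x] eq_0_iff[of x] by linarith

lemma minus: "N (- x) = N x"
  using scaleR[of "-1" x] by simp

lemma diff_commute: "N (x - y) = N (y - x)"
  using minus[of "x - y"] by simp

lemma diff_triangle: "N (x - z) \<le> N (x - y) + N (y - z)"
  using triangle[of "x - y" "y - z"] by simp

lemma triangle_sub: "N x \<le> N y + N (x - y)"
  using triangle[of y "x - y"] by simp

lemma sum_le: "finite I \<Longrightarrow> N (\<Sum>i\<in>I. f i) \<le> (\<Sum>i\<in>I. N (f i))"
proof (induction I rule: finite_induct)
  case (insert i I)
  then show ?case using triangle[of "f i" "sum f I"] by simp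
qed simp

lemma le_norm: obtains K where "K > 0" "\<And>x. N x \<le> K * norm x"
proof
  define K where "K = (\<Sum>b\<in>Basis. N b)"
  have K: "0 \<le> K" unfolding K_def by (intro sum_nonneg nonneg)
  then show "0 < K + 1" by simp
  fix x
  have "N x = N (\<Sum>b\<in>Basis. (x \<bullet> b) *\<^sub>R b)"
    by (simp add: euclidean_representation)
  also have "\<dots> \<le> (\<Sum>b\<in>Basis. N ((x \<bullet> b) *\<^sub>R b))"
    by (rule sum_le) simp
  also have "\<dots> \<le> (\<Sum>b\<in>Basis. norm x * N b)"
    by (intro sum_mono) (simp add: scaleR Basis_le_norm mult_right_mono nonneg)
  also have "\<dots> = K * norm x"
    by (simp add: K_def sum_distrib_left mult.commute)
  also have "\<dots> \<le> (K + 1) * norm x"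
    by (simp add: mult_right_mono)
  finally show "N x \<le> (K + 1) * norm x" .
qed

lemma continuous: "continuous_on A N"
proof -
  obtain K where K: "K > 0" "\<And>x. N x \<le> K * norm x"
    using le_norm by blast
  show ?thesis
  proof (rule lipschitz_on_continuous_on[of K], rule lipschitz_onI)
    fix x y
    have "\<bar>N x - N y\<bar> \<le> N (x - y)"
      using triangle_sub[of x y] triangle_sub[of y x] diff_commute[of x y] by linarith
    also have "\<dots> \<le> K * dist x y" using K(2) by (simp add: dist_norm)
    finally show "dist (N x) (N y) \<le> K * dist x y" by (simp add: dist_real_def)
  qed (use K in simp)
qed

lemma convex_ball: "convex {x. N x < r}"
proof (rule convexI)
  fix x y and s t :: real
  assume *: "x \<in> {x. N x < r}" "y \<in> {x. N x < r}" "0 \<le> s" "0 \<le> t" "s + t = 1"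
  have "N (s *\<^sub>R x + t *\<^sub>R y) \<le> s * N x + t * N y"
    using triangle[of "s *\<^sub>R x" "t *\<^sub>R y"] * by (simp add: scaleR)
  also have "\<dots> < r"
    using convex_bound_lt[of "N x" r "N y" s t] * by simp
  finally show "s *\<^sub>R x + t *\<^sub>R y \<in> {x. N x < r}" by simp
qed

text \<open>Finite-dimensional Hahn-Banach: a hyperplane separates \<open>z\<close> from the open
  \<open>N\<close>-ball of radius \<open>N z\<close>, and rescaling its normal vector gives the
  functional.\<close>

lemma norming_functional:
  assumes "z \<noteq> 0"
  obtains a where "\<And>x. \<bar>a \<bullet> x\<bar> \<le> N x" "a \<bullet> z = N z"
proof -
  have zp: "0 < N z" using pos assms by blast
  have "\<exists>a b. a \<noteq> 0 \<and> (\<forall>x\<in>{x. N x < N z}. a \<bullet> x \<le> b) \<and> (\<forall>x\<in>{z}. b \<le> a \<bullet> x)"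
  proof (rule separating_hyperplane_sets)
    show "{x. N x < N z} \<noteq> {}" using zp zero by (metis empty_iff mem_Collect_eq)
  qed (use convex_ball in auto)
  then obtain a where a: "a \<noteq> 0" "\<And>x. N x < N z \<Longrightarrow> a \<bullet> x \<le> a \<bullet> z"
    by force
  \<comment> \<open>This multiple has norm \<open>N z / 2\<close>. Taken at \<open>x = a\<close>, it
    yields \<open>0 < a \<bullet> z\<close>, by which the rescaling divides.\<close>
  have half: "N ((N z / (2 * N x)) *\<^sub>R x) < N z" if "x \<noteq> 0" for x
    using pos[OF that] zp by (simp add: scaleR)
  have "0 < N z / (2 * N a) * (a \<bullet> a)"
    using pos[OF a(1)] zp a(1) by simp
  also have "\<dots> \<le> a \<bullet> z" using a(2)[OF half[OF a(1)]] by simp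
  finally have az: "0 < a \<bullet> z" .
  have bound: "(a \<bullet> x) * N z \<le> (a \<bullet> z) * N x" for x
  proof (cases "x = 0")
    case False
    then have xp: "0 < N x" by (rule pos)
    \<comment> \<open>The ball is open, so \<open>x\<close> is scaled to norm \<open>t * N z\<close>
      with \<open>t < 1\<close>, and \<open>t\<close> then tends to 1.\<close>
    have "t * ((a \<bullet> x) * N z / N x) \<le> a \<bullet> z" if t: "0 < t" "t < 1" for t
    proof -
      have "N ((t * N z / N x) *\<^sub>R x) < N z" using t xp zp by (simp add: scaleR)
      from a(2)[OF this] show ?thesis by (simp add: field_simps)
    qed
    then have "(a \<bullet> x) * N z / N x \<le> a \<bullet> z"
      by (rule field_le_mult_one_interval)
    then show ?thesis using xp by (simp add: field_simps)
  qed simp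
  define a' where "a' = (N z / (a \<bullet> z)) *\<^sub>R a"
  have le: "a' \<bullet> x \<le> N x" for x
    using bound[of x] az by (simp add: a'_def field_simps)
  show ?thesis
  proof
    show "\<bar>a' \<bullet> x\<bar> \<le> N x" for x
      using le[of x] le[of "- x"] minus[of x] by (simp add: abs_le_iff)
    show "a' \<bullet> z = N z" using az by (simp add: a'_def)
  qed
qed

end

lemma vnorm_norm: "vnorm norm"
  by standard (auto intro: norm_triangle_ineq)

section \<open>Maximal ratio of two norms and the flag\<close>

text \<open>The ratio \<open>v x / N x\<close> is continuous and invariant under scaling, so it
  attains its maximum on the compact Euclidean unit sphere of \<open>V\<close>; the maximiser is
  rescaled to \<open>N z = 1\<close>.\<close>

lemma vnorm_max_ratio:
  assumes "vnorm N" "vnorm v" "subspace V" "dim V \<noteq> 0"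
  obtains z where "z \<in> V" "N z = 1" "v z > 0" "\<And>x. x \<in> V \<Longrightarrow> v x \<le> v z * N x"
proof -
  interpret N: vnorm N by fact
  interpret v: vnorm v by fact
  obtain u where u: "u \<in> V" "u \<noteq> 0"
    using assms(4) by (metis dim_eq_0 subsetI singletonI)
  have sc: "c *\<^sub>R x \<in> V" if "x \<in> V" for c x
    using assms(3) that by (rule subspace_scale)
  define T where "T = sphere 0 1 \<inter> V"
  have "compact T"
    unfolding T_def using closed_subspace[OF assms(3)] by (intro compact_Int_closed) auto
  moreover have "(1 / norm u) *\<^sub>R u \<in> T" using u sc by (simp add: T_def)
  then have "T \<noteq> {}" by blast
  moreover have nz: "x \<noteq> 0" if "x \<in> T" for x using that by (auto simp: T_def)
  moreover have "continuous_on T (\<lambda>x. v x / N x)"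
    using nz by (intro continuous_intros N.continuous v.continuous) (simp add: N.eq_0_iff)
  ultimately obtain t where t: "t \<in> T" "\<And>x. x \<in> T \<Longrightarrow> v x / N x \<le> v t / N t"
    using continuous_attains_sup[of T "\<lambda>x. v x / N x"] by blast
  define z where "z = (1 / N t) *\<^sub>R t"
  have tp: "0 < N t" "0 < v t" using nz t(1) N.pos v.pos by auto
  have vz: "v z = v t / N t" using tp by (simp add: z_def v.scaleR)
  show ?thesis
  proof
    show "z \<in> V" using t(1) sc by (simp add: z_def T_def)
    show "N z = 1" "v z > 0" using tp by (simp_all add: vz z_def N.scaleR v.scaleR)
    fix x assume x: "x \<in> V"
    show "v x \<le> v z * N x"
    proof (cases "x = 0")
      case False
      then have "(1 / norm x) *\<^sub>R x \<in> T" using x sc by (simp add: T_def)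
      from t(2)[OF this] have "v x / N x \<le> v z"
        using False by (simp add: N.scaleR v.scaleR vz)
      then show ?thesis using N.pos[OF False] by (simp add: field_simps)
    qed simp
  qed
qed

text \<open>Equivalence with the Euclidean norm: the maximal ratio for \<open>v = norm\<close> on
  the whole space.\<close>

lemma (in vnorm) norm_le: obtains K where "K > 0" "\<And>x. norm x \<le> K * N x"
proof -
  have "dim (UNIV :: 'a set) \<noteq> 0" by simp
  with vnorm_max_ratio[OF vnorm_axioms vnorm_norm subspace_UNIV]
  show ?thesis using that by (metis UNIV_I)
qed

text \<open>
  One step of the flag. The subtraction in \<open>b - 1\<close> leaves room for the new term of
  \<open>C' = C + b / v z\<close>; the step doubles \<open>b\<close>.
\<close>

lemma flag_step:
  fixes N v :: "'a::euclidean_space \<Rightarrow> real"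
  assumes "vnorm N" "vnorm v" "subspace V" "dim V \<noteq> 0"
    and C: "0 \<le> C" "\<And>z. z \<in> V \<Longrightarrow> C * v z \<le> (b - 1) * N z"
    and b: "1 \<le> b"
    and approx: "\<And>x. \<exists>y\<in>V. N (x - y) \<le> C * v x \<and> v y \<le> b * v x"
  obtains V' C' where "subspace V'" "V' \<subseteq> V" "dim V = Suc (dim V')" "0 \<le> C'"
    "\<And>z. z \<in> V \<Longrightarrow> C' * v z \<le> (2 * b - 1) * N z"
    "\<And>x. \<exists>y\<in>V'. N (x - y) \<le> C' * v x \<and> v y \<le> 2 * b * v x"
proof -
  interpret N: vnorm N by fact
  interpret v: vnorm v by fact
  obtain z where z: "z \<in> V" "N z = 1" "v z > 0" "\<And>x. x \<in> V \<Longrightarrow> v x \<le> v z * N x"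
    using vnorm_max_ratio[OF assms(1-4)] by blast
  then have "z \<noteq> 0" by auto
  then obtain a where a: "\<And>x. \<bar>a \<bullet> x\<bar> \<le> v x" "a \<bullet> z = v z"
    using v.norming_functional by blast
  define V' where "V' = V \<inter> {x. a \<bullet> x = 0}"
  define C' where "C' = C + b / v z"
  have sub: "subspace V'"
    unfolding V'_def by (intro subspace_inter assms(3) subspace_hyperplane)
  have zV': "z \<notin> V'" using a(2) z(3) by (simp add: V'_def)
  \<comment> \<open>Projection onto \<open>V'\<close> along \<open>z\<close>; it also shows that
    \<open>z\<close> and \<open>V'\<close> span \<open>V\<close>, so that exactly one dimension is
    lost.\<close>
  have proj: "y - ((a \<bullet> y) / v z) *\<^sub>R z \<in> V'" if "y \<in> V" for y
    using that z assms(3) a(2) by (simp add: V'_def subspace_diff subspace_scale inner_diff_right)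
  have "V \<subseteq> span (insert z V')"
  proof
    fix y assume "y \<in> V"
    from proj[OF this] have "y - ((a \<bullet> y) / v z) *\<^sub>R z \<in> span V'" by (rule span_base)
    then show "y \<in> span (insert z V')" by (auto simp: span_insert)
  qed
  moreover have "insert z V' \<subseteq> V" using z(1) by (auto simp: V'_def)
  ultimately have "dim V = dim (insert z V')"
    by (metis dim_span dim_subset le_antisym)
  also have "\<dots> = Suc (dim V')"
    using zV' sub by (simp add: dim_insert span_eq_iff[THEN iffD2])
  finally have dim: "dim V = Suc (dim V')" .
  show ?thesis
  proof (rule that[OF sub _ dim])
    show "V' \<subseteq> V" by (simp add: V'_def)
    show "0 \<le> C'" using C b z(3) by (simp add: C'_def)
    show "C' * v x \<le> (2 * b - 1) * N x" if "x \<in> V" for x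
    proof -
      have "b / v z * v x \<le> b * N x"
        using z(3) z(4)[OF that] b by (simp add: field_simps mult_left_mono)
      with C(2)[OF that] show ?thesis by (simp add: C'_def algebra_simps)
    qed
    fix x
    obtain y where y: "y \<in> V" "N (x - y) \<le> C * v x" "v y \<le> b * v x"
      using approx by blast
    define y' where "y' = y - ((a \<bullet> y) / v z) *\<^sub>R z"
    \<comment> \<open>The projection moves \<open>y\<close> by
      \<open>\<bar>a \<bullet> y\<bar> / v z\<close> in \<open>N\<close>, as \<open>N z = 1\<close>,
      and by \<open>\<bar>a \<bullet> y\<bar>\<close> in \<open>v\<close>. Both are controlled
      because \<open>a\<close> is bounded by \<open>v\<close>; the second is why \<open>b\<close>
      doubles.\<close>
    have ay: "\<bar>a \<bullet> y\<bar> \<le> b * v x" using a(1)[of y] y(3) by linarith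
    have "N (y - y') = \<bar>a \<bullet> y\<bar> / v z" using z by (simp add: y'_def N.scaleR)
    also have "\<dots> \<le> b / v z * v x" using ay z(3) by (simp add: field_simps)
    finally have "N (x - y') \<le> C' * v x"
      using y(2) N.diff_triangle[of x y' y] by (simp add: C'_def algebra_simps)
    moreover have "v (y' - y) = \<bar>a \<bullet> y\<bar>" using z(3) by (simp add: y'_def v.minus v.scaleR)
    then have "v y' \<le> 2 * b * v x"
      using v.triangle_sub[of y' y] ay y(3) by linarith
    ultimately show "\<exists>y\<in>V'. N (x - y) \<le> C' * v x \<and> v y \<le> 2 * b * v x"
      using proj[OF y(1)] unfolding y'_def by blast
  qed
qed

section \<open>Products of maps under two norms\<close>

text \<open>Used with \<open>e = 1\<close> for the original norm, with the contraction rate for the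
  adapted norm, and with \<open>set_norm N S\<close> for matrices.\<close>

lemma foldr_le:
  assumes "\<And>s x. s \<in> S \<Longrightarrow> p (act s x) \<le> e * p x" "0 \<le> (e::real)" "set ss \<subseteq> S"
  shows "p (foldr act ss x) \<le> e ^ length ss * p x"
  using assms(3)
proof (induction ss)
  case (Cons s ss)
  have "p (foldr act (s # ss) x) \<le> e * p (foldr act ss x)"
    using assms(1) Cons.prems by simp
  also have "\<dots> \<le> e * (e ^ length ss * p x)"
    using Cons assms(2) by (intro mult_left_mono) auto
  finally show ?case by simp
qed simp

lemma linear_foldr:
  assumes "\<And>s. s \<in> S \<Longrightarrow> linear (act s)" "set ss \<subseteq> S"
  shows "linear (foldr act ss)"
  using assms(2)
proof (induction ss)
  case Nil
  show ?case by (simp add: linear_iff)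
next
  case (Cons s ss)
  then show ?case using assms(1) linear_compose[of "foldr act ss" "act s"] by (simp add: o_def)
qed

text \<open>The word is cut into \<open>DIM('a)\<close> blocks of \<open>m\<close> maps. Each block
  brings the orbit near the next flag subspace at an error of \<open>k * N x\<close>, and earlier
  errors do not grow because no map increases \<open>N\<close>.\<close>

lemma two_norm_contraction:
  fixes N v :: "'a::euclidean_space \<Rightarrow> real" and act :: "'s \<Rightarrow> 'a \<Rightarrow> 'a" and k :: real
  assumes "vnorm N" "vnorm v"
    and lin: "\<And>s. s \<in> S \<Longrightarrow> linear (act s)"
    and N1: "\<And>s x. s \<in> S \<Longrightarrow> N (act s x) \<le> N x"
    and ve: "\<And>s x. s \<in> S \<Longrightarrow> v (act s x) \<le> e * v x"
    and e: "0 \<le> e" "2 ^ (DIM('a) + 1) * e ^ m \<le> k" "DIM('a) * k \<le> 1"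
    and ss: "set ss \<subseteq> S" "length ss = m * DIM('a)"
  shows "N (foldr act ss x) \<le> DIM('a) * k * N x"
proof -
  interpret N: vnorm N by fact
  interpret v: vnorm v by fact
  let ?D = "DIM('a)"
  have "0 \<le> 2 ^ (?D + 1) * e ^ m" using e(1) by simp
  then have k: "0 \<le> k" using e(2) by linarith
  \<comment> \<open>Induction on the codimension \<open>r\<close>. The bounds on \<open>C\<close>
    and the approximation property are the hypotheses of \<open>flag_step\<close> for
    \<open>b = 2 ^ r\<close>; the last property says that \<open>r\<close> blocks bring every orbit
    near \<open>V\<close>.\<close>
  have "\<exists>V C. subspace V \<and> dim V + r = ?D \<and> 0 \<le> C \<and>
      (\<forall>z\<in>V. C * v z \<le> (2 ^ r - 1) * N z) \<and>
      (\<forall>x. \<exists>y\<in>V. N (x - y) \<le> C * v x \<and> v y \<le> 2 ^ r * v x) \<and>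
      (\<forall>ss x. set ss \<subseteq> S \<longrightarrow> length ss = m * r \<longrightarrow>
        (\<exists>y\<in>V. N (foldr act ss x - y) \<le> r * k * N x))"
    if "r \<le> ?D" for r
    using that
  proof (induction r)
    case 0
    have "\<exists>y\<in>UNIV. N (x - y) \<le> 0 * v x \<and> v y \<le> 2 ^ 0 * v x"
      "\<exists>y\<in>UNIV. N (x - y) \<le> 0 * k * N z" for x z
      by (rule bexI[of _ x]; simp)+
    then show ?case
      by (intro exI[of _ UNIV] exI[of _ 0]) (simp add: N.nonneg)
  next
    case (Suc r)
    then obtain V C where V: "subspace V" "dim V + r = ?D" and C: "0 \<le> C"
        "\<And>z. z \<in> V \<Longrightarrow> C * v z \<le> (2 ^ r - 1) * N z"
        "\<And>x. \<exists>y\<in>V. N (x - y) \<le> C * v x \<and> v y \<le> 2 ^ r * v x"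
      and dyn: "\<And>ss x. set ss \<subseteq> S \<Longrightarrow> length ss = m * r \<Longrightarrow>
        \<exists>y\<in>V. N (foldr act ss x - y) \<le> r * k * N x"
      by (metis Suc_leD)
    have "dim V \<noteq> 0" using V(2) Suc.prems by linarith
    then obtain V' C' where V': "subspace V'" "V' \<subseteq> V" "dim V = Suc (dim V')" and C': "0 \<le> C'"
        "\<And>z. z \<in> V \<Longrightarrow> C' * v z \<le> (2 * 2 ^ r - 1) * N z"
        "\<And>x. \<exists>y\<in>V'. N (x - y) \<le> C' * v x \<and> v y \<le> 2 * 2 ^ r * v x"
      using flag_step[OF assms(1,2) V(1) _ C(1,2) _ C(3)] by (metis one_le_numeral one_le_power)
    have "\<exists>y\<in>V'. N (foldr act ss x - y) \<le> Suc r * k * N x"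
      if ss: "set ss \<subseteq> S" "length ss = m * Suc r" for ss x
    proof -
      \<comment> \<open>\<open>foldr\<close> applies the end of the list first, so the induction
        hypothesis concerns \<open>cs\<close>, and \<open>bs\<close> is the new block.\<close>
      define bs where "bs = take m ss"
      define cs where "cs = drop m ss"
      have split: "ss = bs @ cs" and lens: "length bs = m" "length cs = m * r"
        using ss(2) by (simp_all add: bs_def cs_def)
      have bcS: "set bs \<subseteq> S" "set cs \<subseteq> S" using ss(1) split by auto
      obtain y where y: "y \<in> V" "N (foldr act cs x - y) \<le> r * k * N x"
        using dyn[OF bcS(2) lens(2)] by blast
      \<comment> \<open>Keeping the accumulated error at most \<open>N x\<close> gives
        \<open>N y \<le> 2 * N x\<close>; this 2 is the extra factor in
        \<open>2 ^ (DIM('a) + 1)\<close>.\<close>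
      have "r * k \<le> 1" using e(3) k Suc.prems
        by (smt (verit) Suc_leD mult_right_mono of_nat_le_iff)
      then have "r * k * N x \<le> 1 * N x" using N.nonneg by (intro mult_right_mono) auto
      moreover have "N (foldr act cs x) \<le> N x"
        using foldr_le[OF _ _ bcS(2), of N act 1 x] N1 by simp
      ultimately have Ny: "N y \<le> 2 * N x"
        using y(2) N.triangle_sub[of y "foldr act cs x"] N.diff_commute[of y] by (smt (verit))
      obtain y' where y': "y' \<in> V'" "N (foldr act bs y - y') \<le> C' * v (foldr act bs y)"
        using C'(3) by blast
      \<comment> \<open>The distance from \<open>foldr act bs y\<close> to \<open>V'\<close> is
        bounded through \<open>v\<close>, which the block contracts by \<open>e ^ m\<close>. Back at
        \<open>y\<close>, which lies in \<open>V\<close>, \<open>C' * v\<close> is bounded by a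
        multiple of \<open>N\<close>.\<close>
      have "v (foldr act bs y) \<le> e ^ m * v y"
        using foldr_le[OF _ e(1) bcS(1), of v act y] ve lens(1) by simp
      then have "C' * v (foldr act bs y) \<le> e ^ m * (C' * v y)"
        using C'(1) by (simp add: mult_left_mono mult.left_commute)
      also have "\<dots> \<le> e ^ m * (2 ^ ?D * (2 * N x))"
      proof (intro mult_left_mono)
        have "C' * v y \<le> 2 ^ Suc r * N y"
          using C'(2)[OF y(1)] N.nonneg[of y] by (simp add: algebra_simps)
        also have "\<dots> \<le> 2 ^ ?D * (2 * N x)"
          using Ny N.nonneg Suc.prems by (intro mult_mono power_increasing) auto
        finally show "C' * v y \<le> 2 ^ ?D * (2 * N x)" .
      qed (use e(1) in simp)
      also have "\<dots> = 2 ^ (?D + 1) * e ^ m * N x" by simp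
      also have "\<dots> \<le> k * N x" using e(2) N.nonneg by (intro mult_right_mono) auto
      finally have 1: "N (foldr act bs y - y') \<le> k * N x" using y'(2) by linarith
      \<comment> \<open>By linearity the old error is carried along by \<open>bs\<close>, without
        growing in \<open>N\<close>.\<close>
      have "foldr act ss x - foldr act bs y = foldr act bs (foldr act cs x - y)"
        using linear_diff[OF linear_foldr[OF lin bcS(1)]] by (simp add: split)
      then have "N (foldr act ss x - foldr act bs y) \<le> r * k * N x"
        using foldr_le[OF _ _ bcS(1), of N act 1 "foldr act cs x - y"] N1 y(2) by simp
      with 1 have "N (foldr act ss x - y') \<le> Suc r * k * N x"
        using N.diff_triangle[of "foldr act ss x" y' "foldr act bs y"] by (simp add: algebra_simps)
      with y'(1) show ?thesis by blast
    qed
    moreover have "\<forall>z\<in>V'. C' * v z \<le> (2 ^ Suc r - 1) * N z"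
      using C'(2) V'(2) by auto
    ultimately show ?case
      using V'(1,3) V(2) C'(1,3) by (intro exI[of _ V'] exI[of _ C']) auto
  qed
  from this[of ?D] obtain V where V: "dim V = 0"
      "\<And>ss x. set ss \<subseteq> S \<Longrightarrow> length ss = m * ?D \<Longrightarrow>
        \<exists>y\<in>V. N (foldr act ss x - y) \<le> ?D * k * N x"
    by auto
  from V(2)[OF ss] obtain y where "y \<in> V" "N (foldr act ss x - y) \<le> ?D * k * N x" by blast
  moreover have "y = 0" using V(1) \<open>y \<in> V\<close> by (auto simp: dim_eq_0)
  ultimately show ?thesis by simp
qed

section \<open>The norm of Rota and Strang\<close>

text \<open>The supremum over all words of \<open>N (foldr act ss x) / e ^ length ss\<close> is
  finite by \<open>M\<close>, and at least \<open>N x\<close> by the empty word, hence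
  definite.\<close>

lemma adapted_norm:
  fixes N :: "'a::euclidean_space \<Rightarrow> real" and act :: "'s \<Rightarrow> 'a \<Rightarrow> 'a"
  assumes "vnorm N"
    and lin: "\<And>s. s \<in> S \<Longrightarrow> linear (act s)"
    and e: "0 < e"
    and M: "\<And>ss x. set ss \<subseteq> S \<Longrightarrow> N (foldr act ss x) \<le> M * e ^ length ss * N x"
  obtains v where "vnorm v" "\<And>s x. s \<in> S \<Longrightarrow> v (act s x) \<le> e * v x"
proof -
  interpret N: vnorm N by fact
  define q where "q = (\<lambda>x ss. N (foldr act ss x) / e ^ length ss)"
  define v where "v = (\<lambda>x. SUP ss\<in>lists S. q x ss)"
  have "q x ss \<le> M * N x" if "ss \<in> lists S" for x ss
    using M[of ss x] that e by (auto simp: q_def field_simps lists_eq_set)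
  then have bdd: "bdd_above (q x ` lists S)" for x by (intro bdd_aboveI2)
  have upper: "q x ss \<le> v x" if "ss \<in> lists S" for x ss
    unfolding v_def using that by (intro cSUP_upper bdd)
  have least: "v x \<le> B" if "\<And>ss. ss \<in> lists S \<Longrightarrow> q x ss \<le> B" for x B
    unfolding v_def using that by (intro cSUP_least) auto
  have Nv: "N x \<le> v x" for x
    using upper[of "[]" x] by (simp add: q_def)
  have linf: "linear (foldr act ss)" if "ss \<in> lists S" for ss
    using linear_foldr[OF lin] that by (auto simp: lists_eq_set)
  have q_scale: "q (c *\<^sub>R x) ss = \<bar>c\<bar> * q x ss" if "ss \<in> lists S" for c x ss
    using linear_scale[OF linf[OF that]] by (simp add: q_def N.scaleR)
  have v0: "v 0 \<le> 0"
    using least[of 0 0] q_scale[of _ 0 0] by simp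
  have v_scale_le: "v (c *\<^sub>R x) \<le> \<bar>c\<bar> * v x" for c x
    by (rule least) (simp add: q_scale upper mult_left_mono)
  show ?thesis
  proof
    show "vnorm v"
    proof
      show vnn: "0 \<le> v x" for x using Nv[of x] N.nonneg[of x] by linarith
      show "v x = 0 \<longleftrightarrow> x = 0" for x
        using Nv[of x] N.pos[of x] v0 vnn[of 0] by (cases "x = 0") auto
      show "v (c *\<^sub>R x) = \<bar>c\<bar> * v x" for c x
      proof (cases "c = 0")
        case True
        then show ?thesis using v0 vnn[of 0] by simp
      next
        case False
        have "v x \<le> \<bar>1 / c\<bar> * v (c *\<^sub>R x)"
          using v_scale_le[of "1 / c" "c *\<^sub>R x"] False by simp
        then have "\<bar>c\<bar> * v x \<le> v (c *\<^sub>R x)"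
          using False by (simp add: field_simps)
        with v_scale_le[of c x] show ?thesis by linarith
      qed
      show "v (x + y) \<le> v x + v y" for x y
      proof (rule least)
        fix ss assume ss: "ss \<in> lists S"
        have "q (x + y) ss \<le> q x ss + q y ss"
          using linear_add[OF linf[OF ss]] e N.triangle
          by (simp add: q_def add_divide_distrib[symmetric] divide_right_mono)
        with upper[OF ss, of x] upper[OF ss, of y] show "q (x + y) ss \<le> v x + v y" by linarith
      qed
    qed
    fix s x assume s: "s \<in> S"
    show "v (act s x) \<le> e * v x"
    proof (rule least)
      fix ss assume ss: "ss \<in> lists S"
      \<comment> \<open>Acting by \<open>s\<close> first appends \<open>s\<close> to the word; the
        longer word has one more \<open>e\<close> in its denominator.\<close>
      have "q (act s x) ss = e * q x (ss @ [s])"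
        using e by (simp add: q_def)
      also have "\<dots> \<le> e * v x"
        using ss s e by (intro mult_left_mono upper) (auto simp: lists_eq_set)
      finally show "q (act s x) ss \<le> e * v x" .
    qed
  qed
qed

section \<open>Growth rate of a submultiplicative sequence\<close>

text \<open>Fekete's lemma in root form, the limit being the infimum of the roots. The last
  conclusion supplies the constant \<open>M\<close> for the adapted norm at any rate above the
  limit.\<close>

lemma submultiplicative_root_limit:
  fixes f :: "nat \<Rightarrow> real"
  assumes nonneg: "\<And>n. 0 \<le> f n" and sub: "\<And>m n. f (m + n) \<le> f m * f n"
  obtains L where "(\<lambda>n. root n (f n)) \<longlonglongrightarrow> L" "0 \<le> L"
    "\<And>t. L < t \<Longrightarrow> \<exists>M. \<forall>n. f n \<le> M * t ^ n"
proof -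
  define a where "a = (\<lambda>n. root n (f n))"
  \<comment> \<open>Index 0 is left out because \<open>root 0\<close> is constantly 0.\<close>
  define L where "L = Inf (a ` {1..})"
  have a0: "0 \<le> a n" for n using nonneg by (simp add: a_def real_root_ge_zero)
  have bdd: "bdd_below (a ` {1..})" using a0 by (intro bdd_belowI2)
  have L0: "0 \<le> L" unfolding L_def using a0 by (intro cINF_greatest) auto
  have La: "L \<le> a n" if "n \<ge> 1" for n
    unfolding L_def using that by (intro cINF_lower bdd) auto
  have growth: "\<exists>M>0. \<forall>n. f n \<le> M * t ^ n" if Lt: "L < t" for t
  proof -
    have t: "0 < t" using Lt L0 by linarith
    obtain n0 where n0: "n0 \<ge> 1" "a n0 < t"
      using Lt cInf_lessD[of "a ` {1..}" t] by (auto simp: L_def)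
    have "f n0 = a n0 ^ n0" using n0 nonneg by (simp add: a_def real_root_pow_pos2)
    also have "\<dots> \<le> t ^ n0" using n0 a0 by (intro power_mono) auto
    finally have fn0: "f n0 \<le> t ^ n0" .
    \<comment> \<open>\<open>M\<close> bounds \<open>f r / t ^ r\<close> for all remainders
      \<open>r\<close> modulo \<open>n0\<close>; the summand 1 keeps it positive, so that
      \<open>root n M\<close> tends to 1.\<close>
    define M where "M = 1 + (\<Sum>r<n0. f r / t ^ r)"
    have "0 \<le> (\<Sum>r<n0. f r / t ^ r)" using nonneg t by (intro sum_nonneg) auto
    then have M: "0 < M" by (simp add: M_def)
    have small: "f r \<le> M * t ^ r" if "r < n0" for r
    proof -
      have "f r / t ^ r \<le> (\<Sum>r<n0. f r / t ^ r)"
        using that nonneg t by (intro member_le_sum) auto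
      then have "f r / t ^ r \<le> M" by (simp add: M_def)
      then show ?thesis using t by (simp add: field_simps)
    qed
    have "f (q * n0 + r) \<le> M * t ^ (q * n0 + r)" if "r < n0" for q r
    proof (induction q)
      case (Suc q)
      have "f (Suc q * n0 + r) \<le> f n0 * f (q * n0 + r)"
        using sub[of n0 "q * n0 + r"] by (simp add: add.assoc)
      also have "\<dots> \<le> t ^ n0 * (M * t ^ (q * n0 + r))"
        using fn0 Suc nonneg t by (intro mult_mono) auto
      finally show ?case by (simp add: power_add algebra_simps)
    qed (use small that in simp)
    from this[of "n mod n0" "n div n0" for n] have "f n \<le> M * t ^ n" for n
      using n0 by simp
    with M show ?thesis by blast
  qed
  have "a \<longlonglongrightarrow> L"
  proof (rule order_tendstoI)
    fix y assume "y < L"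
    then show "\<forall>\<^sub>F n in sequentially. y < a n"
      using La by (intro eventually_sequentiallyI[of 1]) (meson less_le_trans)
  next
    fix y assume "L < y"
    then obtain t where t: "L < t" "t < y" using dense by blast
    then have "0 < t" using L0 by linarith
    obtain M where M: "0 < M" "\<And>n. f n \<le> M * t ^ n" using growth[OF t(1)] by blast
    have "(\<lambda>n. root n M * t) \<longlonglongrightarrow> 1 * t"
      using M by (intro tendsto_intros LIMSEQ_root_const)
    then have "\<forall>\<^sub>F n in sequentially. root n M * t < y"
      using t(2) by (intro order_tendstoD(2)) auto
    then show "\<forall>\<^sub>F n in sequentially. a n < y"
      using eventually_gt_at_top[of 0]
    proof eventually_elim
      case (elim n)
      have "a n \<le> root n (M * t ^ n)"
        unfolding a_def using elim M by (intro real_root_le_mono) auto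
      also have "\<dots> = root n M * t"
        using elim \<open>0 < t\<close> by (simp add: real_root_mult real_root_power_cancel)
      finally show ?case using elim by linarith
    qed
  qed
  then show ?thesis using that[of L] L0 growth unfolding a_def by blast
qed

section \<open>Complex matrices as real-linear maps\<close>

lemma linear_matrix_vector_mult: "linear (\<lambda>x. A *v (x :: complex ^ 'n))"
proof (rule linearI)
  fix x y :: "complex ^ 'n" and c :: real
  show "A *v (x + y) = A *v x + A *v y" by (rule matrix_vector_right_distrib)
  show "A *v (c *\<^sub>R x) = c *\<^sub>R (A *v x)"
    by (simp add: vec_eq_iff matrix_vector_mult_def scaleR_sum_right)
qed

text \<open>A crude entrywise estimate. Only the existence of some constant matters: it makes the
  suprema in operator norms finite.\<close>

lemma norm_matrix_vector_mult_le:
  fixes A :: "complex ^ 'n ^ 'm" and x :: "complex ^ 'n"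
  shows "norm (A *v x) \<le> real CARD('m) * (real CARD('n) * (norm A * norm x))"
proof -
  have "norm (A *v x) \<le> (\<Sum>i\<in>UNIV. norm ((A *v x) $ i))"
    unfolding norm_vec_def by (rule L2_set_le_sum) simp
  also have "\<dots> \<le> (\<Sum>i\<in>(UNIV :: 'm set). real CARD('n) * (norm A * norm x))"
  proof (rule sum_mono)
    fix i
    have "norm ((A *v x) $ i) \<le> (\<Sum>j\<in>UNIV. norm (A $ i $ j * x $ j))"
      unfolding matrix_vector_mult_def vec_lambda_beta by (rule norm_sum)
    also have "\<dots> \<le> (\<Sum>j\<in>(UNIV :: 'n set). norm A * norm x)"
    proof (rule sum_mono)
      fix j
      have "norm (A $ i $ j) \<le> norm A"
        by (rule order_trans[OF Finite_Cartesian_Product.norm_nth_le Finite_Cartesian_Product.norm_nth_le])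
      then show "norm (A $ i $ j * x $ j) \<le> norm A * norm x"
        unfolding norm_mult by (intro mult_mono Finite_Cartesian_Product.norm_nth_le) auto
    qed
    finally show "norm ((A *v x) $ i) \<le> real CARD('n) * (norm A * norm x)" by simp
  qed
  finally show ?thesis by simp
qed

lemma foldr_matrix_mult_append:
  "foldr (**) (As @ Bs) (mat 1) = foldr (**) As (mat 1) ** (foldr (**) Bs (mat 1) :: 'a::semiring_1 ^ 'n ^ 'n)"
  by (induction As) (simp_all add: matrix_mul_assoc)

lemma foldr_matrix_mult_vector:
  "foldr (**) As (mat 1) *v x = foldr (*v) As (x :: 'a::semiring_1 ^ 'n)"
  by (induction As) (simp_all add: matrix_vector_mul_assoc[symmetric])

lemma foldr_scaled_matrix:
  "foldr (\<lambda>A x. c *\<^sub>R (A *v x)) As x = c ^ length As *\<^sub>R foldr (*v) As (x :: complex ^ 'n)"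
  by (induction As) (simp_all add: linear_scale[OF linear_matrix_vector_mult])

section \<open>Operator norms and norms of sets of matrices\<close>

locale matrix_norm =
  fixes N :: "complex ^ 'd \<Rightarrow> real"
  assumes is_norm: "is_norm N"
begin

sublocale vnorm N
proof
  show "N (c *\<^sub>R x) = \<bar>c\<bar> * N x" for c x
  proof -
    have "c *\<^sub>R x = complex_of_real c *s x"
      unfolding vec_eq_iff by (simp add: scaleR_conv_of_real[of c "_ :: complex"])
    then show ?thesis using is_norm by (simp add: is_norm_def)
  qed
qed (use is_norm in \<open>auto simp: is_norm_def\<close>)

text \<open>The Euclidean estimate carried over to \<open>N\<close> by equivalence of norms. It is
  linear in \<open>norm A\<close>, so one constant serves a whole bounded set.\<close>

lemma matrix_bound:
  obtains K where "K > 0" "\<And>A (x :: complex ^ 'd). N (A *v x) \<le> K * norm A * N x"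
proof -
  obtain B where B: "B > 0" "\<And>x. N x \<le> B * norm x" using le_norm by blast
  obtain c where c: "c > 0" "\<And>x. norm x \<le> c * N x" using norm_le by blast
  let ?d = "real CARD('d)"
  show ?thesis
  proof
    show "0 < B * (?d * (?d * c))" using B c by simp
    fix A and x :: "complex ^ 'd"
    have "N (A *v x) \<le> B * norm (A *v x)" by (rule B)
    also have "\<dots> \<le> B * (?d * (?d * (norm A * norm x)))"
      using B by (intro mult_left_mono norm_matrix_vector_mult_le) auto
    also have "\<dots> \<le> B * (?d * (?d * (norm A * (c * N x))))"
      using B c by (intro mult_left_mono) auto
    finally show "N (A *v x) \<le> B * (?d * (?d * c)) * norm A * N x"
      by (simp add: mult_ac)
  qed
qed

lemma op_norm_le:
  assumes "\<And>x. N (A *v x) \<le> B * N x" "0 \<le> B"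
  shows "op_norm N A \<le> B"
  unfolding op_norm_def
proof (rule cSUP_least)
  show "N (A *v x) / N x \<le> B" for x
    using assms pos[of x] by (cases "x = 0") (simp_all add: pos_divide_le_eq)
qed simp

lemma le_op_norm: "N (A *v x) \<le> op_norm N A * N x"
proof (cases "x = 0")
  case False
  obtain K where K: "K > 0" "\<And>A (x :: complex ^ 'd). N (A *v x) \<le> K * norm A * N x"
    using matrix_bound by blast
  have "N (A *v x) / N x \<le> K * norm A" for x
    using K pos[of x] by (cases "x = 0") (simp_all add: pos_divide_le_eq)
  then have "N (A *v x) / N x \<le> op_norm N A"
    unfolding op_norm_def by (intro cSUP_upper bdd_aboveI2) auto
  then show ?thesis using pos[OF False] by (simp add: pos_divide_le_eq)
qed simp

lemma op_norm_nonneg: "0 \<le> op_norm N A"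
proof -
  have "(1 :: complex ^ 'd) \<noteq> 0" by simp
  then have "0 < N 1" by (rule pos)
  moreover have "0 \<le> op_norm N A * N 1"
    using le_op_norm nonneg by (rule order_trans[rotated])
  ultimately show ?thesis by (simp add: zero_le_mult_iff)
qed

lemma op_norm_mult: "op_norm N (A ** B) \<le> op_norm N A * op_norm N B"
proof (rule op_norm_le)
  fix x
  have "N ((A ** B) *v x) \<le> op_norm N A * N (B *v x)"
    by (simp add: matrix_vector_mul_assoc[symmetric] le_op_norm)
  also have "\<dots> \<le> op_norm N A * (op_norm N B * N x)"
    by (intro mult_left_mono le_op_norm op_norm_nonneg)
  finally show "N ((A ** B) *v x) \<le> op_norm N A * op_norm N B * N x" by simp
qed (simp add: op_norm_nonneg)

lemma bdd_op_norm:
  assumes "bounded S"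
  shows "bdd_above (op_norm N ` S)"
proof -
  obtain K where K: "K > 0" "\<And>A (x :: complex ^ 'd). N (A *v x) \<le> K * norm A * N x"
    using matrix_bound by blast
  obtain B where B: "\<And>A. A \<in> S \<Longrightarrow> norm A \<le> B" using assms by (auto simp: bounded_iff)
  show ?thesis
  proof (rule bdd_aboveI2)
    fix A assume "A \<in> S"
    have "op_norm N A \<le> K * norm A" using K by (intro op_norm_le) auto
    also have "\<dots> \<le> K * B" using B[OF \<open>A \<in> S\<close>] K by simp
    finally show "op_norm N A \<le> K * B" .
  qed
qed

lemma set_norm_le:
  assumes "\<And>A. A \<in> S \<Longrightarrow> op_norm N A \<le> B" "0 \<le> B"
  shows "set_norm N S \<le> B"
  unfolding set_norm_def using assms by (intro cSup_least) auto

lemma op_norm_le_set_norm: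
  assumes "bdd_above (op_norm N ` S)" "A \<in> S"
  shows "op_norm N A \<le> set_norm N S"
  unfolding set_norm_def using assms by (intro cSup_upper) auto

lemma set_norm_nonneg:
  assumes "bdd_above (op_norm N ` S)"
  shows "0 \<le> set_norm N S"
  unfolding set_norm_def using assms by (intro cSup_upper) auto

end

section \<open>Product sets of a bounded set of matrices\<close>

locale bounded_matrix_set = matrix_norm N for N :: "complex ^ 'd \<Rightarrow> real" +
  fixes S :: "(complex ^ 'd ^ 'd) set"
  assumes bounded: "bounded S"
begin

abbreviation \<sigma> :: "nat \<Rightarrow> real" where
  "\<sigma> n \<equiv> set_norm N (prod_set S n)"

lemma set_norm_S_nonneg: "0 \<le> set_norm N S"
  by (intro set_norm_nonneg bdd_op_norm bounded)

lemma op_norm_prod_set_le: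
  assumes "A \<in> prod_set S n"
  shows "op_norm N A \<le> set_norm N S ^ n"
proof (rule op_norm_le)
  obtain As where As: "A = foldr (**) As (mat 1)" "length As = n" "set As \<subseteq> S"
    using assms unfolding prod_set_def by blast
  have "N (B *v x) \<le> set_norm N S * N x" if "B \<in> S" for B x
    using le_op_norm mult_right_mono[OF op_norm_le_set_norm[OF bdd_op_norm[OF bounded] that] nonneg]
    by (rule order_trans)
  then show "N (A *v x) \<le> set_norm N S ^ n * N x" for x
    using foldr_le[OF _ set_norm_S_nonneg As(3), of N "(*v)" x] As(1,2)
    by (simp add: foldr_matrix_mult_vector)
qed (simp add: set_norm_S_nonneg)

lemma bdd_prod_set: "bdd_above (op_norm N ` prod_set S n)"
  using op_norm_prod_set_le by (intro bdd_aboveI2)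

lemma set_norm_prod_set_nonneg: "0 \<le> \<sigma> n"
  by (intro set_norm_nonneg bdd_prod_set)

lemma set_norm_prod_set_le_power: "\<sigma> n \<le> set_norm N S ^ n"
  by (intro set_norm_le op_norm_prod_set_le) (simp_all add: set_norm_S_nonneg)

lemma set_norm_prod_set_add: "\<sigma> (m + n) \<le> \<sigma> m * \<sigma> n"
proof (rule set_norm_le)
  fix A assume "A \<in> prod_set S (m + n)"
  then obtain As where As: "A = foldr (**) As (mat 1)" "length As = m + n" "set As \<subseteq> S"
    unfolding prod_set_def by blast
  define B C where "B = foldr (**) (take m As) (mat 1)" and "C = foldr (**) (drop m As) (mat 1)"
  have "B \<in> prod_set S m" "C \<in> prod_set S n"
    unfolding prod_set_def B_def C_def mem_Collect_eq
    by (rule exI[of _ "take m As"], use As(2,3) set_take_subset[of m As] in auto,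
        rule exI[of _ "drop m As"], use As(2,3) set_drop_subset[of m As] in auto)
  then have BC: "op_norm N B \<le> \<sigma> m" "op_norm N C \<le> \<sigma> n"
    by (simp_all add: op_norm_le_set_norm bdd_prod_set)
  have "A = B ** C"
    unfolding As(1) B_def C_def by (simp flip: foldr_matrix_mult_append)
  then have "op_norm N A \<le> op_norm N B * op_norm N C" by (simp add: op_norm_mult)
  also have "\<dots> \<le> \<sigma> m * \<sigma> n"
    using BC by (intro mult_mono op_norm_nonneg set_norm_prod_set_nonneg)
  finally show "op_norm N A \<le> \<sigma> m * \<sigma> n" .
qed (simp add: set_norm_prod_set_nonneg)

lemma foldr_le_set_norm_prod_set:
  assumes "set As \<subseteq> S"
  shows "N (foldr (*v) As x) \<le> \<sigma> (length As) * N x"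
proof -
  have "foldr (**) As (mat 1) \<in> prod_set S (length As)"
    using assms unfolding prod_set_def by blast
  then have "op_norm N (foldr (**) As (mat 1)) \<le> \<sigma> (length As)"
    by (rule op_norm_le_set_norm[OF bdd_prod_set])
  from order_trans[OF le_op_norm mult_right_mono[OF this nonneg]] show ?thesis
    by (simp only: foldr_matrix_mult_vector)
qed

text \<open>The two-norm contraction with \<open>m = CARD('d)\<close> and \<open>k = 8 * e\<close>
  in real dimension \<open>2 * CARD('d)\<close>, which makes the word length
  \<open>2 * CARD('d) ^ 2\<close>.\<close>

lemma set_norm_prod_set_le_rate:
  assumes t: "0 < t" "2 ^ 7 * real CARD('d) ^ 4 * t < set_norm N S"
    and M: "\<And>n. \<sigma> n \<le> M * t ^ n"
    and n: "n = 2 * CARD('d) ^ 2"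
  shows "\<sigma> n \<le> 2 ^ 7 * real CARD('d) ^ 4 * t * set_norm N S ^ (n - 1)"
proof -
  let ?d = "CARD('d)" and ?s = "set_norm N S"
  \<comment> \<open>Dividing the action by \<open>?s\<close> makes every element of \<open>S\<close>
    nonexpansive for \<open>N\<close> and turns the rate \<open>t\<close> into
    \<open>e\<close>.\<close>
  define e where "e = t / ?s"
  define act where "act = (\<lambda>(A :: complex ^ 'd ^ 'd) x. (1 / ?s) *\<^sub>R (A *v x))"
  have d: "1 \<le> ?d" by (simp add: Suc_leI)
  have "0 \<le> 2 ^ 7 * real ?d ^ 4 * t" using t by simp
  then have s: "0 < ?s" using t(2) by linarith
  have d4: "real ?d \<le> real ?d ^ 4" using d by (intro self_le_power) auto
  have e0: "0 < e" using t s by (simp add: e_def)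
  have "2 ^ 7 * real ?d ^ 4 * e \<le> 1" using t s by (simp add: e_def field_simps)
  moreover have "2 ^ 7 * real ?d * e \<le> 2 ^ 7 * real ?d ^ 4 * e"
    using e0 d4 by (intro mult_right_mono mult_left_mono) auto
  \<comment> \<open>One smallness condition serves both \<open>4 * e \<le> 1\<close> and the
    requirement that the real dimension times \<open>k = 8 * e\<close> be at most 1.\<close>
  ultimately have de: "2 ^ 7 * real ?d * e \<le> 1" by linarith
  moreover have "1 * e \<le> real ?d * e" using e0 d by (intro mult_right_mono) auto
  ultimately have e4: "4 * e \<le> 1" by simp
  have lin: "linear (act A)" for A
    unfolding act_def by (intro linear_compose_scale_right linear_matrix_vector_mult)
  have fold: "N (foldr act As x) = N (foldr (*v) As x) / ?s ^ length As" for As x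
    unfolding act_def using s by (simp add: foldr_scaled_matrix scaleR power_one_over)
  have "N (foldr act As x) \<le> M * e ^ length As * N x" if "set As \<subseteq> S" for As x
  proof -
    have "N (foldr (*v) As x) \<le> M * t ^ length As * N x"
      using foldr_le_set_norm_prod_set[OF that] mult_right_mono[OF M nonneg] by (rule order_trans)
    then show ?thesis
      unfolding fold e_def using s by (simp add: divide_right_mono field_simps)
  qed
  from adapted_norm[OF vnorm_axioms lin e0 this]
  obtain v where v: "vnorm v" "\<And>A x. A \<in> S \<Longrightarrow> v (act A x) \<le> e * v x" by metis
  have N1: "N (act A x) \<le> N x" if "A \<in> S" for A x
  proof -
    have "N (A *v x) \<le> ?s * N x"
      using le_op_norm mult_right_mono[OF op_norm_le_set_norm[OF bdd_op_norm[OF bounded] that] nonneg]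
      by (rule order_trans)
    then show ?thesis using s by (simp add: act_def scaleR field_simps)
  qed
  have D: "DIM(complex ^ 'd) = 2 * ?d" by simp
  \<comment> \<open>The product to bound is \<open>2 * (4 * e) ^ ?d\<close>: one factor
    \<open>4 * e\<close> is kept and the other \<open>j\<close> are bounded by 1.\<close>
  obtain j where j: "?d = Suc j" using d by (cases ?d) auto
  have "(4 * e) ^ j \<le> 1" using e4 e0 by (intro power_le_one) auto
  then have "8 * e * (4 * e) ^ j \<le> 8 * e * 1" using e0 by (intro mult_left_mono) auto
  moreover have "2 ^ (2 * ?d + 1) * e ^ ?d = 8 * e * (4 * e) ^ j"
    by (simp add: j power_mult power_mult_distrib)
  ultimately have k: "2 ^ (2 * ?d + 1) * e ^ ?d \<le> 8 * e" by linarith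
  have contr: "N (foldr act As x) \<le> 16 * real ?d * e * N x"
    if As: "set As \<subseteq> S" "length As = n" for As x
  proof -
    have len: "length As = ?d * DIM(complex ^ 'd)"
      using As(2) n by (simp add: power2_eq_square)
    have "N (foldr act As x) \<le> DIM(complex ^ 'd) * (8 * e) * N x"
    proof (rule two_norm_contraction[OF vnorm_axioms v(1), where S = S and act = act and e = e and m = "?d"])
      show "2 ^ (DIM(complex ^ 'd) + 1) * e ^ ?d \<le> 8 * e" "DIM(complex ^ 'd) * (8 * e) \<le> 1"
        unfolding D using k de e0 d by simp_all
    qed (use e0 As(1) len in \<open>simp_all add: lin N1 v(2)\<close>)
    then show ?thesis by (simp add: mult_ac)
  qed
  have "0 < n" using n by simp
  then have n1: "?s ^ n = ?s * ?s ^ (n - 1)"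
    by (metis power_minus_mult mult.commute)
  show ?thesis
  proof (rule set_norm_le)
    fix A assume "A \<in> prod_set S n"
    then obtain As where As: "A = foldr (**) As (mat 1)" "length As = n" "set As \<subseteq> S"
      unfolding prod_set_def by blast
    show "op_norm N A \<le> 2 ^ 7 * real ?d ^ 4 * t * ?s ^ (n - 1)"
    proof (rule op_norm_le)
      fix x
      have "N (A *v x) \<le> 16 * real ?d * e * N x * ?s ^ n"
        using contr[OF As(3,2)] s As(2) by (simp add: As(1) foldr_matrix_mult_vector fold field_simps)
      \<comment> \<open>The normalisation is undone by \<open>e * ?s ^ n = t * ?s ^ (n - 1)\<close>.
        The factor \<open>16 * ?d\<close> obtained is within \<open>2 ^ 7 * ?d ^ 4\<close>.\<close>
      also have "\<dots> = real ?d * (16 * (t * ?s ^ (n - 1) * N x))"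
        using s by (simp add: n1 e_def)
      also have "\<dots> \<le> real ?d ^ 4 * (2 ^ 7 * (t * ?s ^ (n - 1) * N x))"
        using d4 s t nonneg by (intro mult_mono) auto
      finally show "N (A *v x) \<le> 2 ^ 7 * real ?d ^ 4 * t * ?s ^ (n - 1) * N x"
        by (simp add: mult_ac)
    qed (use s t in simp)
  qed (use s t in simp)
qed

end

section \<open>Passage to the joint spectral radius\<close>

text \<open>The bound is proved with any \<open>t\<close> above the limit \<open>L\<close> in place
  of the radius, and \<open>t\<close> then decreases to \<open>L\<close>. Since \<open>t > 0\<close>
  throughout, this covers \<open>L = 0\<close> as well.\<close>

theorem theorem6:
  fixes N :: "complex ^ 'd \<Rightarrow> real"
    and S :: "(complex ^ 'd ^ 'd) set"
    and n1 :: nat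
  assumes "is_norm N"
    and "bounded S"
    and "n1 = 2 * CARD('d) ^ 2"
  shows "set_norm N (prod_set S n1)
           \<le> 2 ^ 7 * real CARD('d) ^ 4 * joint_spectral_radius N S * set_norm N S ^ (n1 - 1)"
proof -
  interpret bounded_matrix_set N S by unfold_locales fact+
  let ?s = "set_norm N S" and ?c = "2 ^ 7 * real CARD('d) ^ 4"
  obtain L where L: "(\<lambda>n. root n (\<sigma> n)) \<longlonglongrightarrow> L" "0 \<le> L"
      "\<And>t. L < t \<Longrightarrow> \<exists>M. \<forall>n. \<sigma> n \<le> M * t ^ n"
    using submultiplicative_root_limit[of \<sigma>] set_norm_prod_set_nonneg set_norm_prod_set_add
    by metis
  have rho: "joint_spectral_radius N S = L"
    unfolding joint_spectral_radius_def using L(1) by (rule limI)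
  have "0 < n1" using assms(3) by simp
  have bound: "\<sigma> n1 \<le> ?c * t * ?s ^ (n1 - 1)" if t: "L < t" for t
  proof (cases "?c * t < ?s")
    case True
    obtain M where "\<forall>n. \<sigma> n \<le> M * t ^ n" using L(3)[OF t] by blast
    then show ?thesis using True L(2) t assms(3) by (intro set_norm_prod_set_le_rate) auto
  next
    \<comment> \<open>For \<open>t\<close> large against \<open>?s\<close>, submultiplicativity
      alone suffices; \<open>?s = 0\<close> falls under this case.\<close>
    case False
    have "\<sigma> n1 \<le> ?s ^ n1" by (rule set_norm_prod_set_le_power)
    also have "\<dots> = ?s * ?s ^ (n1 - 1)"
      using \<open>0 < n1\<close> by (metis power_minus_mult mult.commute)
    also have "\<dots> \<le> ?c * t * ?s ^ (n1 - 1)"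
      using False set_norm_S_nonneg by (intro mult_right_mono) auto
    finally show ?thesis .
  qed
  have "((\<lambda>t. ?c * t * ?s ^ (n1 - 1)) \<longlongrightarrow> ?c * L * ?s ^ (n1 - 1)) (at_right L)"
    by (intro tendsto_intros)
  moreover have "\<forall>\<^sub>F t in at_right L. \<sigma> n1 \<le> ?c * t * ?s ^ (n1 - 1)"
    using bound by (auto simp: eventually_at_filter)
  ultimately show ?thesis
    unfolding rho by (intro tendsto_lowerbound[where F = "at_right L"]) auto
qed

end
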